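(* For every $s\in\mathbb C$ and every $z\in\mathbb C$ with $|z|<1$, $$z\frac{d}{dz}\log G_{s+1}(z)=\log G_s(z).$$
   Context: $\zeta$ is the Riemann zeta function. For $s\in\mathbb C$ and $|z|<1$ the polylogarithmic gamma function is $$G_s(z):=\exp\left(\sum_{r=2}^{\infty}\frac{\zeta(r)}{r^s}z^r\right),$$ and $\log G_s(z)$ denotes the series $\sum_{r=2}^{\infty}\frac{\zeta(r)}{r^s}z^r$ in the exponent. *)

theory Defs
  imports "HOL-Analysis.Analysis" "HOL-Real_Asymp.Real_Asymp"
begin

text \<open>
  The Riemann zeta function on the half-plane \<open>Re s > 1\<close>, where it is given by its Dirichlet
  series. The polylogarithmic gamma function only involves its values at the integers
  \<open>r \<ge> 2\<close>, so the analytic continuation is not needed; for \<open>Re s \<le> 1\<close> the value of this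
  constant is not meaningful.
\<close>
definition riemann_zeta :: "complex \<Rightarrow> complex" where
  "riemann_zeta s = (\<Sum>n. 1 / of_nat (Suc n) powr s)"

text \<open>
  The exponent series \<open>\<Sum>r=2..\<infinity>. \<zeta>(r) / r\<^sup>s \<cdot> z\<^sup>r\<close>, with the summation index shifted by 2.
  \<open>log_G s z\<close> denotes this series itself, not a branch of the logarithm of \<open>G s z\<close>.
  As \<open>r\<close> is a positive real, \<open>r powr s = exp (s * ln r)\<close> with the real logarithm.
\<close>
definition log_G_term :: "complex \<Rightarrow> complex \<Rightarrow> nat \<Rightarrow> complex" where
  "log_G_term s z r = riemann_zeta (of_nat r) / of_nat r powr s * z ^ r"

definition log_G :: "complex \<Rightarrow> complex \<Rightarrow> complex" where
  "log_G s z = (\<Sum>r. log_G_term s z (r + 2))"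

definition G :: "complex \<Rightarrow> complex \<Rightarrow> complex" where
  "G s z = exp (log_G s z)"

text \<open>The series above converge wherever they are used.\<close>

lemma norm_zeta_term:
  "norm (1 / of_nat (Suc n) powr s :: complex) = real (Suc n) powr (- Re s)"
proof -
  have "norm (complex_of_nat (Suc n) powr s) = real (Suc n) powr Re s"
    using norm_powr_real_powr[of "of_nat (Suc n)" s] by (simp del: of_nat_Suc)
  thus ?thesis by (simp add: norm_divide powr_minus_divide del: of_nat_Suc)
qed

lemma summable_norm_riemann_zeta:
  assumes "Re s > 1"
  shows   "summable (\<lambda>n. norm (1 / of_nat (Suc n) powr s :: complex))"
proof -
  have "summable (\<lambda>n. real n powr (- Re s))"
    using assms by (subst summable_real_powr_iff) auto
  hence "summable (\<lambda>n. real (Suc n) powr (- Re s))"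
    by (subst summable_Suc_iff)
  thus ?thesis by (simp only: norm_zeta_term)
qed

lemma norm_riemann_zeta_le:
  assumes "r \<ge> 2"
  shows   "norm (riemann_zeta (of_nat r)) \<le> (\<Sum>n. real (Suc n) powr (-2))"
proof -
  have s: "summable (\<lambda>n. real (Suc n) powr (- real r))"
    using summable_norm_riemann_zeta[of "of_nat r"] assms by (simp only: norm_zeta_term) auto
  have s2: "summable (\<lambda>n. real (Suc n) powr (- 2))"
    using summable_norm_riemann_zeta[of 2] by (simp only: norm_zeta_term) auto
  have "norm (riemann_zeta (of_nat r)) \<le> (\<Sum>n. real (Suc n) powr (- real r))"
    using summable_norm[OF summable_norm_riemann_zeta[of "of_nat r"]] assms
    unfolding riemann_zeta_def norm_zeta_term by simp
  also have "\<dots> \<le> (\<Sum>n. real (Suc n) powr (-2))"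
    by (intro suminf_le s s2 powr_mono) (use assms in auto)
  finally show ?thesis .
qed

lemma summable_log_G_term:
  assumes "norm z < 1"
  shows   "summable (\<lambda>r. log_G_term s z (r + 2))"
proof (cases "z = 0")
  case True
  thus ?thesis by (simp add: log_G_term_def)
next
  case False
  define C where "C = (\<Sum>n. real (Suc n) powr (-2))"
  define a where "a = norm z"
  define t where "t = - Re s"
  define c where "c = (a + 1) / 2"
  have a: "0 < a" "a < c" "0 < c" "c < 1" using assms False by (auto simp: a_def c_def add_nonneg_pos)
  have "(\<lambda>r. real (r + 2) powr t * a ^ (r + 2)) \<in> O(\<lambda>r. c ^ r)"
    using a by real_asymp
  moreover have "summable (\<lambda>r. norm (c ^ r))"
    using a by (simp add: norm_power summable_geometric)
  ultimately have "summable (\<lambda>r. real (r + 2) powr t * a ^ (r + 2))"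
    by (rule summable_comparison_test_bigo[rotated])
  hence *: "summable (\<lambda>r. C * (real (r + 2) powr t * a ^ (r + 2)))"
    by (rule summable_mult)
  show ?thesis
  proof (rule summable_comparison_test'[OF *])
    fix r :: nat
    have "norm (complex_of_nat (r + 2) powr s) = real (r + 2) powr Re s"
      using norm_powr_real_powr[of "of_nat (r + 2)" s] by (simp del: of_nat_add)
    moreover have "norm (riemann_zeta (of_nat (r + 2))) \<le> C"
      unfolding C_def by (rule norm_riemann_zeta_le) simp
    ultimately show "norm (log_G_term s z (r + 2)) \<le> C * (real (r + 2) powr t * a ^ (r + 2))"
      unfolding log_G_term_def norm_mult norm_divide norm_power a_def t_def powr_minus_divide
      by (simp add: mult_right_mono divide_right_mono del: of_nat_add power_Suc power_add)
  qed
qed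

end

theory Submission
  imports Defs
begin

text \<open>The operator z d/dz multiplies the coefficient of z^r by r, and r / r^(s+1) = 1 / r^s,
  so it lowers the order from s+1 to s. \<open>of_nat_mult_log_G_coeff\<close> is this identity of
  coefficients; \<open>log_G_has_field_derivative\<close> justifies termwise differentiation in the
  open unit disc. \<open>log_G_coeff\<close> pads the series with zeros at r = 0 and r = 1, so that
  the library results on power series apply without an index shift.\<close>

definition log_G_coeff :: "complex \<Rightarrow> nat \<Rightarrow> complex" where
  "log_G_coeff s r = (if r < 2 then 0 else riemann_zeta (of_nat r) / of_nat r powr s)"

lemma of_nat_mult_log_G_coeff: "of_nat r * log_G_coeff (s + 1) r = log_G_coeff s r"
  by (simp add: log_G_coeff_def powr_add)

lemma log_G_coeff_sums:
  assumes "norm z < 1"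
  shows   "(\<lambda>r. log_G_coeff s r * z ^ r) sums log_G s z"
proof -
  have "(\<lambda>r. log_G_coeff s (r + 2) * z ^ (r + 2)) sums log_G s z"
    using summable_log_G_term[OF assms, of s]
    by (simp add: log_G_def log_G_term_def log_G_coeff_def sums_iff)
  thus ?thesis
    by (subst (asm) sums_iff_shift) (simp add: log_G_coeff_def numeral_2_eq_2)
qed

lemma log_G_has_field_derivative:
  assumes "norm z < 1"
  shows   "(log_G s has_field_derivative (\<Sum>r. diffs (log_G_coeff s) r * z ^ r)) (at z)"
proof (rule has_field_derivative_transform_within)
  show "((\<lambda>w. \<Sum>r. log_G_coeff s r * w ^ r) has_field_derivative
          (\<Sum>r. diffs (log_G_coeff s) r * z ^ r)) (at z)"
    using log_G_coeff_sums assms by (intro termdiffs_strong'[of 1]) (auto simp: sums_iff)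
  \<comment> \<open>The ball of this radius around z stays inside the unit disc, where the padded
    series is known to sum to \<open>log_G s\<close>.\<close>
  show "0 < 1 - norm z" using assms by simp
  show "z \<in> UNIV" by simp
  show "(\<Sum>r. log_G_coeff s r * w ^ r) = log_G s w" if "dist w z < 1 - norm z" for w
  proof -
    have "norm w < 1" using norm_triangle_sub[of w z] that by (simp add: dist_norm)
    thus ?thesis using log_G_coeff_sums by (simp add: sums_iff)
  qed
qed

theorem proposition3p5:
  fixes s z :: complex
  assumes "norm z < 1"
  shows "log_G (s + 1) field_differentiable (at z) \<and> z * deriv (log_G (s + 1)) z = log_G s z"
proof
  let ?c = "log_G_coeff (s + 1)"
  note D = log_G_has_field_derivative[OF assms, of "s + 1"]
  show "log_G (s + 1) field_differentiable (at z)"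
    using D by (auto simp: field_differentiable_def)
  have "summable (\<lambda>r. diffs ?c r * z ^ r)"
    using log_G_coeff_sums assms by (intro termdiff_converges[of _ 1]) (auto simp: sums_iff)
  \<comment> \<open>\<open>diffs\<close> shifts the index by one; \<open>diffs_equiv\<close> undoes
    this, so that the factor z turns z^(r-1) back into z^r.\<close>
  hence "(\<lambda>r. z * (of_nat r * ?c r * z ^ (r - Suc 0))) sums (z * (\<Sum>r. diffs ?c r * z ^ r))"
    by (intro sums_mult diffs_equiv)
  moreover have "z * (of_nat r * ?c r * z ^ (r - Suc 0)) = log_G_coeff s r * z ^ r" for r
    \<comment> \<open>At r = 0 the truncated exponent leaves z on the left against 1 on the right;
      both sides vanish because the coefficient is zero there.\<close>
    unfolding of_nat_mult_log_G_coeff by (cases r) (simp_all add: log_G_coeff_def)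
  ultimately have "(\<lambda>r. log_G_coeff s r * z ^ r) sums (z * (\<Sum>r. diffs ?c r * z ^ r))"
    by simp
  thus "z * deriv (log_G (s + 1)) z = log_G s z"
    using log_G_coeff_sums[OF assms, of s] DERIV_imp_deriv[OF D] sums_unique2 by metis
qed

end
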